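(* Let $d\ge 2$, $E=\mathbb R^d$, and for $\boldsymbol\beta=(\beta_1,\beta_2,\beta_3)\in\mathbb C^3$ let $B_{\boldsymbol\beta}$ be the following differential operator on $E\times E$ (acting in the variables $(y,z)$): $$\begin{aligned}B_{\boldsymbol\beta}=\;&|y-z|^2\Delta_y\Delta_z\\&+2(\beta_3+\beta_1+d)\sum_{j=1}^d(z_j-y_j)\frac{\partial}{\partial y_j}\Delta_z+2(\beta_2+\beta_1+d)\sum_{j=1}^d(y_j-z_j)\frac{\partial}{\partial z_j}\Delta_y\\&+(\beta_3+\beta_1+d)(\beta_3+\beta_1+2)\Delta_z+(\beta_2+\beta_1+d)(\beta_2+\beta_1+2)\Delta_y\\&-2(\beta_3+\beta_1+d)(\beta_2+\beta_1+d)\sum_{j=1}^d\frac{\partial^2}{\partial y_j\partial z_j}.\end{aligned}$$ Then, for every $\boldsymbol\beta\in\mathbb C^3$, at all points $(x,y,z)\in E^3$ with $x,y,z$ pairwise distinct, $$B_{\boldsymbol\beta}\,l_{(\beta_1+2,\beta_2,\beta_3)}=b(\boldsymbol\beta)\,l_{\boldsymbol\beta},$$ where $$b(\boldsymbol\beta)=(\beta_1+d)(\beta_1+2)(\beta_1+\beta_2+\beta_3+2d)(\beta_1+\beta_2+\beta_3+d+2).$$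
   Context: $|\cdot|$ is the Euclidean norm. For $\boldsymbol\beta\in\mathbb C^3$, $l_{\boldsymbol\beta}(x,y,z)=|x-y|^{\beta_3}\,|y-z|^{\beta_1}\,|z-x|^{\beta_2}$, a smooth function on the open set of triples of pairwise distinct points of $E$. $\Delta_y=\sum_j\partial^2/\partial y_j^2$ and $\Delta_z=\sum_j\partial^2/\partial z_j^2$ are the Euclidean Laplacians. The variable $x$ is a parameter on which $B_{\boldsymbol\beta}$ does not act. *)

theory Defs
  imports "HOL-Analysis.Analysis"
begin

(* The derivative of f in direction v, as a function of the point; its value at p only depends
   on f near p. As usual for vector_derivative, it is unspecified where the derivative does
   not exist. *)
definition dir_deriv ::
  "'a::real_normed_vector \<Rightarrow> ('a \<Rightarrow> complex) \<Rightarrow> 'a \<Rightarrow> complex" where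
  "dir_deriv v f p = vector_derivative (\<lambda>t::real. f (p + t *\<^sub>R v)) (at 0)"

(* The partial derivatives with respect to y_j and z_j of a function of (y, z). *)
definition partial_y ::
  "'n::finite \<Rightarrow> ((real^'n) \<times> (real^'n) \<Rightarrow> complex) \<Rightarrow> (real^'n) \<times> (real^'n) \<Rightarrow> complex" where
  "partial_y j = dir_deriv (axis j 1, 0)"

definition partial_z ::
  "'n::finite \<Rightarrow> ((real^'n) \<times> (real^'n) \<Rightarrow> complex) \<Rightarrow> (real^'n) \<times> (real^'n) \<Rightarrow> complex" where
  "partial_z j = dir_deriv (0, axis j 1)"

definition laplacian_y ::
  "((real^'n) \<times> (real^'n) \<Rightarrow> complex) \<Rightarrow> (real^'n) \<times> (real^'n) \<Rightarrow> complex" where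
  "laplacian_y f p = (\<Sum>j\<in>UNIV. partial_y j (partial_y j f) p)"

definition laplacian_z ::
  "((real^'n) \<times> (real^'n) \<Rightarrow> complex) \<Rightarrow> (real^'n) \<times> (real^'n) \<Rightarrow> complex" where
  "laplacian_z f p = (\<Sum>j\<in>UNIV. partial_z j (partial_z j f) p)"

(* The base of each power is a nonnegative real, so for pairwise distinct points
   r powr b = exp (b * ln r) with the real logarithm of r > 0. *)
definition l_fun :: "complex^3 \<Rightarrow> real^'n \<Rightarrow> real^'n \<Rightarrow> real^'n \<Rightarrow> complex" where
  "l_fun \<beta> x y z =
     complex_of_real (norm (x - y)) powr (\<beta>$3) *
     complex_of_real (norm (y - z)) powr (\<beta>$1) *
     complex_of_real (norm (z - x)) powr (\<beta>$2)"

definition B_op ::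
  "complex^3 \<Rightarrow> ((real^'n) \<times> (real^'n) \<Rightarrow> complex) \<Rightarrow> (real^'n) \<times> (real^'n) \<Rightarrow> complex" where
  "B_op \<beta> f = (\<lambda>(y, z).
     let d = of_nat CARD('n) in
       complex_of_real ((norm (y - z))\<^sup>2) * laplacian_y (laplacian_z f) (y, z)
     + 2 * (\<beta>$3 + \<beta>$1 + d) *
         (\<Sum>j\<in>UNIV. complex_of_real (z$j - y$j) * partial_y j (laplacian_z f) (y, z))
     + 2 * (\<beta>$2 + \<beta>$1 + d) *
         (\<Sum>j\<in>UNIV. complex_of_real (y$j - z$j) * partial_z j (laplacian_y f) (y, z))
     + (\<beta>$3 + \<beta>$1 + d) * (\<beta>$3 + \<beta>$1 + 2) * laplacian_z f (y, z)
     + (\<beta>$2 + \<beta>$1 + d) * (\<beta>$2 + \<beta>$1 + 2) * laplacian_y f (y, z)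
     - 2 * (\<beta>$3 + \<beta>$1 + d) * (\<beta>$2 + \<beta>$1 + d) *
         (\<Sum>j\<in>UNIV. partial_y j (partial_z j f) (y, z)))"

definition b_poly :: "nat \<Rightarrow> complex^3 \<Rightarrow> complex" where
  "b_poly d \<beta> =
     (\<beta>$1 + of_nat d) * (\<beta>$1 + 2) *
     (\<beta>$1 + \<beta>$2 + \<beta>$3 + 2 * of_nat d) *
     (\<beta>$1 + \<beta>$2 + \<beta>$3 + of_nat d + 2)"

end

theory Submission
  imports Defs
begin

text \<open>
  On the open set where \<open>x\<close>, \<open>y\<close>, \<open>z\<close> are pairwise distinct, write
  \<open>M(a,b,c) = |x-y|\<^sup>a |y-z|\<^sup>b |z-x|\<^sup>c\<close> and \<open>P\<close>, \<open>Q\<close>, \<open>R\<close> for the squares of the three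
  distances. Differentiating \<open>M(a,b,c)\<close> lowers an exponent by 2 and produces the side vectors
  \<open>y-x\<close>, \<open>y-z\<close>, \<open>z-x\<close> as factors. Each operator that makes up \<open>B\<close> is invariant under rotations,
  so these vectors come together in inner products only; by the law of cosines twice such an inner
  product is a signed sum of \<open>P\<close>, \<open>Q\<close>, \<open>R\<close>, and multiplying by \<open>P\<close>, \<open>Q\<close> or \<open>R\<close> raises an exponent
  by 2. Hence each operator maps \<open>M(a,b,c)\<close> to a linear combination of such products again:
  \<open>laplacian_y_mono_sum\<close>, \<open>euler_y_mono_sum\<close> and \<open>mixed_dist_mono\<close> compute it for the Laplacian,
  for the first-order operator \<open>\<Sum>(z\<^sub>j - y\<^sub>j) \<partial>/\<partial>y\<^sub>j\<close> and for the mixed second-order term. The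
  formulas for the operators in \<open>z\<close> follow by exchanging \<open>y\<close> and \<open>z\<close>, which exchanges \<open>a\<close> and \<open>c\<close>.

  Applied to \<open>M(\<beta>\<^sub>3, \<beta>\<^sub>1 + 2, \<beta>\<^sub>2)\<close>, all terms of \<open>B\<close> are polynomial multiples, in \<open>P\<close>, \<open>Q\<close>, \<open>R\<close>,
  of the single function \<open>M(\<beta>\<^sub>3 - 2, \<beta>\<^sub>1 - 2, \<beta>\<^sub>2 - 2)\<close>, and these multiples are homogeneous of
  degree 3. The coefficients of \<open>B\<close> are such that only the monomial \<open>P Q R\<close> survives, with
  coefficient \<open>b(\<beta>)\<close>: this is an identity between polynomials in \<open>\<beta>\<close>, \<open>d\<close>, \<open>P\<close>, \<open>Q\<close>, \<open>R\<close>.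

  Linear combinations are represented by lists of weighted exponent triples. The operators then act
  on lists, and composing two of them, as in \<open>\<Delta>\<^sub>y \<Delta>\<^sub>z\<close>, needs no further differentiation.
\<close>

section \<open>Products of powers of the three distances\<close>

definition dist_mono ::
  "real^'n \<Rightarrow> complex \<Rightarrow> complex \<Rightarrow> complex \<Rightarrow> (real^'n) \<times> (real^'n) \<Rightarrow> complex" where
  "dist_mono x a b c = (\<lambda>(y, z).
     complex_of_real (norm (x - y)) powr a *
     complex_of_real (norm (y - z)) powr b *
     complex_of_real (norm (z - x)) powr c)"

definition distinct_locus :: "'a::real_normed_vector \<Rightarrow> ('a \<times> 'a) set" where
  "distinct_locus x = {(y, z). x \<noteq> y \<and> y \<noteq> z \<and> z \<noteq> x}"

lemma open_distinct_locus: "open (distinct_locus x)"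
proof -
  have "distinct_locus x = {p. fst p \<noteq> x} \<inter> {p. fst p \<noteq> snd p} \<inter> {p. snd p \<noteq> x}"
    by (auto simp: distinct_locus_def)
  then show ?thesis
    by (auto intro!: open_Int open_Collect_neq continuous_intros)
qed

lemma swap_distinct_locus: "(z, y) \<in> distinct_locus x \<longleftrightarrow> (y, z) \<in> distinct_locus x"
  by (auto simp: distinct_locus_def)

lemma norm_powr_add_2:
  fixes a :: complex
  assumes "w \<noteq> 0"
  shows "complex_of_real (norm w) powr (a + 2)
       = complex_of_real ((norm w)\<^sup>2) * complex_of_real (norm w) powr a"
  using assms by (simp add: powr_add powr_numeral)

lemma dist_mono_shift:
  assumes "(y, z) \<in> distinct_locus x"
  shows "dist_mono x (a + 2) b c (y, z) = complex_of_real ((norm (x - y))\<^sup>2) * dist_mono x a b c (y, z)"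
    and "dist_mono x a (b + 2) c (y, z) = complex_of_real ((norm (y - z))\<^sup>2) * dist_mono x a b c (y, z)"
    and "dist_mono x a b (c + 2) (y, z) = complex_of_real ((norm (z - x))\<^sup>2) * dist_mono x a b c (y, z)"
  using assms norm_powr_add_2[of "x - y" a] norm_powr_add_2[of "y - z" b] norm_powr_add_2[of "z - x" c]
  by (simp_all add: distinct_locus_def dist_mono_def)

text \<open>
  These turn the inner products of side vectors that differentiation produces into the factors that
  \<open>dist_mono_shift\<close> absorbs into the exponents. The two side vectors in the last one do not both
  end at \<open>z\<close>, hence the reversed sign.
\<close>

lemma law_of_cosines:
  fixes x y z :: "'a::real_inner"
  shows "2 * ((y - x) \<bullet> (y - z)) = (norm (x - y))\<^sup>2 + (norm (y - z))\<^sup>2 - (norm (z - x))\<^sup>2"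
    and "2 * ((z - x) \<bullet> (y - x)) = (norm (x - y))\<^sup>2 + (norm (z - x))\<^sup>2 - (norm (y - z))\<^sup>2"
    and "2 * ((z - x) \<bullet> (y - z)) = (norm (x - y))\<^sup>2 - (norm (y - z))\<^sup>2 - (norm (z - x))\<^sup>2"
  by (simp_all add: power2_norm_eq_inner inner_diff_left inner_diff_right inner_commute)

lemma sum_component_products:
  fixes u w :: "real^'n"
  shows "(\<Sum>j\<in>UNIV. complex_of_real (u $ j) * complex_of_real (w $ j)) = complex_of_real (u \<bullet> w)"
  by (simp add: inner_vec_def)

section \<open>Directional derivatives\<close>

lemma dir_deriv_eqI:
  assumes "((\<lambda>t. f (p + t *\<^sub>R v)) has_vector_derivative D) (at 0)"
  shows "dir_deriv v f p = D"
  using assms by (simp add: dir_deriv_def vector_derivative_at)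

text \<open>
  Formulas for first derivatives are available on the open set of distinct triples only. Locality
  allows them to be substituted before differentiating again.
\<close>

lemma dir_deriv_cong:
  assumes "open U" "p \<in> U" and "\<And>q. q \<in> U \<Longrightarrow> f q = g q"
  shows "dir_deriv v f p = dir_deriv v g p"
proof -
  have "((\<lambda>t::real. p + t *\<^sub>R v) \<longlongrightarrow> p + 0 *\<^sub>R v) (nhds 0)"
    by (intro tendsto_intros filterlim_ident)
  then have "\<forall>\<^sub>F t in nhds (0::real). p + t *\<^sub>R v \<in> U"
    using assms(1,2) by (auto dest: topological_tendstoD)
  then have "\<forall>\<^sub>F t in nhds (0::real). f (p + t *\<^sub>R v) = g (p + t *\<^sub>R v)"
    by eventually_elim (rule assms(3))
  then show ?thesis
    unfolding dir_deriv_def by (intro vector_derivative_cong_eq) (auto simp: eventually_mono)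
qed

lemma laplacian_y_cong:
  assumes "open U" "p \<in> U" and "\<And>q. q \<in> U \<Longrightarrow> f q = g q"
  shows "laplacian_y f p = laplacian_y g p"
  unfolding laplacian_y_def partial_y_def
  by (intro sum.cong refl dir_deriv_cong[OF assms(1,2)] dir_deriv_cong[OF assms(1)] assms(3))

lemma has_vector_derivative_norm_powr:
  fixes w v :: "'a::real_inner"
  assumes "w \<noteq> 0"
  shows "((\<lambda>t. complex_of_real (norm (w + t *\<^sub>R v)) powr a) has_vector_derivative
          a * complex_of_real (w \<bullet> v) * complex_of_real (norm w) powr (a - 2)) (at 0)"
proof -
  let ?r = "complex_of_real (norm w)"
  have "((\<lambda>t::real. w + t *\<^sub>R v) has_derivative (\<lambda>h. h *\<^sub>R v)) (at 0)"
    by (auto intro!: derivative_eq_intros)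
  moreover have "(norm has_derivative (\<lambda>h. sgn w \<bullet> h)) (at (w + 0 *\<^sub>R v))"
    using has_derivative_norm[OF assms] by (simp add: inner_commute)
  ultimately have "((\<lambda>t. norm (w + t *\<^sub>R v)) has_derivative (\<lambda>h. sgn w \<bullet> (h *\<^sub>R v))) (at 0)"
    by (rule has_derivative_compose)
  then have "((\<lambda>t. norm (w + t *\<^sub>R v)) has_vector_derivative ((w \<bullet> v) / norm w)) (at 0)"
    by (simp add: has_vector_derivative_def sgn_div_norm divide_simps)
  then have "((\<lambda>t. complex_of_real (norm (w + t *\<^sub>R v))) has_vector_derivative
      complex_of_real ((w \<bullet> v) / norm w)) (at 0)"
    by (intro has_vector_derivative_of_real)
      (simp add: has_real_derivative_iff_has_vector_derivative)
  moreover have "((\<lambda>s. s powr a) has_field_derivative a * ?r powr (a - 1))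
      (at (complex_of_real (norm (w + 0 *\<^sub>R v))))"
    using assms by (auto intro!: has_field_derivative_powr simp: complex_nonpos_Reals_iff)
  ultimately have "((\<lambda>s. s powr a) \<circ> (\<lambda>t. complex_of_real (norm (w + t *\<^sub>R v))) has_vector_derivative
      complex_of_real ((w \<bullet> v) / norm w) * (a * ?r powr (a - 1))) (at 0)"
    by (rule field_vector_diff_chain_at)
  moreover have "?r powr (a - 1) = ?r * ?r powr (a - 2)"
    using assms powr_add[of ?r 1 "a - 2"] by (simp add: powr_one)
  ultimately show ?thesis
    using assms by (simp add: o_def mult_ac)
qed

lemma has_vector_derivative_dist_mono:
  assumes "(y, z) \<in> distinct_locus x"
  shows "((\<lambda>t. dist_mono x a b c ((y, z) + t *\<^sub>R (u, w))) has_vector_derivative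
           (a * complex_of_real ((y - x) \<bullet> u) * dist_mono x (a - 2) b c (y, z)
          + b * complex_of_real ((y - z) \<bullet> (u - w)) * dist_mono x a (b - 2) c (y, z)
          + c * complex_of_real ((z - x) \<bullet> w) * dist_mono x a b (c - 2) (y, z))) (at 0)"
proof -
  have ne: "x - y \<noteq> 0" "y - z \<noteq> 0" "z - x \<noteq> 0"
    using assms by (auto simp: distinct_locus_def)
  have line: "(\<lambda>t. dist_mono x a b c ((y, z) + t *\<^sub>R (u, w))) = (\<lambda>t.
      complex_of_real (norm ((x - y) + t *\<^sub>R (- u))) powr a *
      complex_of_real (norm ((y - z) + t *\<^sub>R (u - w))) powr b *
      complex_of_real (norm ((z - x) + t *\<^sub>R w)) powr c)"
    by (simp add: dist_mono_def algebra_simps)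
  show ?thesis
    unfolding line
    by (rule has_vector_derivative_eq_rhs[OF has_vector_derivative_mult[OF has_vector_derivative_mult
          [OF has_vector_derivative_norm_powr[OF ne(1)] has_vector_derivative_norm_powr[OF ne(2)]]
            has_vector_derivative_norm_powr[OF ne(3)]]])
      (simp add: dist_mono_def algebra_simps)
qed

lemma has_vector_derivative_component:
  "((\<lambda>t. complex_of_real (u $ j + t)) has_vector_derivative 1) (at 0)"
  using has_vector_derivative_of_real[of "\<lambda>t. u $ j + t" 1 "at 0"]
  by (auto intro!: derivative_eq_intros)

lemma has_vector_derivative_sum_list:
  assumes "\<And>e. e \<in> set es \<Longrightarrow> ((\<lambda>t. f e t) has_vector_derivative D e) F"
  shows "((\<lambda>t. \<Sum>e\<leftarrow>es. f e t) has_vector_derivative (\<Sum>e\<leftarrow>es. D e)) F"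
  using assms by (induction es) (auto intro!: derivative_intros)

section \<open>Linear combinations and their Laplacians\<close>

type_synonym dist_term = "complex \<times> complex \<times> complex \<times> complex"

definition mono_sum :: "real^'n \<Rightarrow> dist_term list \<Rightarrow> (real^'n) \<times> (real^'n) \<Rightarrow> complex" where
  "mono_sum x es p = (\<Sum>(k, a, b, c)\<leftarrow>es. k * dist_mono x a b c p)"

lemma sum_list_mono_sum: "(\<Sum>e\<leftarrow>es. mono_sum x (h e) p) = mono_sum x (concat (map h es)) p"
  by (induction es) (simp_all add: mono_sum_def)

lemma sum_sum_list_swap: "(\<Sum>j\<in>J. \<Sum>e\<leftarrow>es. g j e) = (\<Sum>e\<leftarrow>es. \<Sum>j\<in>J. g j e)"
  for g :: "'i \<Rightarrow> 'e \<Rightarrow> 'b::comm_monoid_add"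
  by (induction es) (simp_all add: sum.distrib)

definition dist_mono_dy ::
  "real^'n \<Rightarrow> 'n \<Rightarrow> complex \<Rightarrow> complex \<Rightarrow> complex \<Rightarrow> (real^'n) \<times> (real^'n) \<Rightarrow> complex" where
  "dist_mono_dy x j a b c = (\<lambda>(y, z).
     a * complex_of_real ((y - x) $ j) * dist_mono x (a - 2) b c (y, z)
   + b * complex_of_real ((y - z) $ j) * dist_mono x a (b - 2) c (y, z))"

lemma has_vector_derivative_dist_mono_y:
  assumes "(y, z) \<in> distinct_locus x"
  shows "((\<lambda>t. dist_mono x a b c ((y, z) + t *\<^sub>R (axis j 1, 0))) has_vector_derivative
           dist_mono_dy x j a b c (y, z)) (at 0)"
  by (rule has_vector_derivative_eq_rhs[OF has_vector_derivative_dist_mono[OF assms]])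
    (simp add: dist_mono_dy_def inner_axis)

lemma partial_y_mono_sum:
  assumes "(y, z) \<in> distinct_locus x"
  shows "partial_y j (mono_sum x es) (y, z) = (\<Sum>(k, a, b, c)\<leftarrow>es. k * dist_mono_dy x j a b c (y, z))"
  unfolding partial_y_def mono_sum_def
proof (rule dir_deriv_eqI, rule has_vector_derivative_sum_list)
  fix e :: dist_term
  obtain k a b c where e: "e = (k, a, b, c)" by (cases e)
  show "((\<lambda>t. case e of (k, a, b, c) \<Rightarrow> k * dist_mono x a b c ((y, z) + t *\<^sub>R (axis j 1, 0)))
     has_vector_derivative (case e of (k, a, b, c) \<Rightarrow> k * dist_mono_dy x j a b c (y, z))) (at 0)"
    unfolding e prod.case
    by (rule has_vector_derivative_mult_right[OF has_vector_derivative_dist_mono_y[OF assms]])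
qed

lemma has_vector_derivative_dist_mono_dy:
  assumes "(y, z) \<in> distinct_locus x"
  shows "((\<lambda>t. dist_mono_dy x j a b c ((y, z) + t *\<^sub>R (axis j 1, 0))) has_vector_derivative
     (a * (dist_mono x (a - 2) b c (y, z)
           + complex_of_real ((y - x) $ j) * dist_mono_dy x j (a - 2) b c (y, z))
    + b * (dist_mono x a (b - 2) c (y, z)
           + complex_of_real ((y - z) $ j) * dist_mono_dy x j a (b - 2) c (y, z)))) (at 0)"
proof -
  have line: "(\<lambda>t. dist_mono_dy x j a b c ((y, z) + t *\<^sub>R (axis j 1, 0))) = (\<lambda>t.
      a * (complex_of_real ((y - x) $ j + t) * dist_mono x (a - 2) b c ((y, z) + t *\<^sub>R (axis j 1, 0)))
    + b * (complex_of_real ((y - z) $ j + t) * dist_mono x a (b - 2) c ((y, z) + t *\<^sub>R (axis j 1, 0))))"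
    by (simp add: dist_mono_dy_def fun_eq_iff algebra_simps)
  note D = has_vector_derivative_mult[OF has_vector_derivative_component
      has_vector_derivative_dist_mono_y[OF assms]]
  show ?thesis
    unfolding line
    by (rule has_vector_derivative_eq_rhs[OF has_vector_derivative_add[OF
       has_vector_derivative_mult_right[OF D] has_vector_derivative_mult_right[OF D]]])
      (simp add: add.commute)
qed

definition laplacian_y_terms :: "complex \<Rightarrow> dist_term \<Rightarrow> dist_term list" where
  "laplacian_y_terms d = (\<lambda>(k, a, b, c).
     [(k * a * (a + b - 2 + d), a - 2, b, c),
      (k * b * (a + b - 2 + d), a, b - 2, c),
      (- k * a * b, a - 2, b - 2, c + 2)])"

text \<open>
  The cross terms of the second derivatives add up to
  \<open>2 a b ((y - x) \<bullet> (y - z)) M(a-2, b-2, c) = a b (P + Q - R) M(a-2, b-2, c)\<close>. Its first two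
  parts are \<open>a b M(a, b-2, c)\<close> and \<open>a b M(a-2, b, c)\<close>: this is where the factor \<open>a + b - 2 + d\<close>
  comes from, in place of the \<open>a - 2 + d\<close> and \<open>b - 2 + d\<close> of a single power. The third part is the
  last entry of \<open>laplacian_y_terms\<close>.
\<close>

lemma laplacian_y_mono_sum:
  fixes x y z :: "real^'n"
  assumes "(y, z) \<in> distinct_locus x"
  shows "laplacian_y (mono_sum x es) (y, z)
       = mono_sum x (concat (map (laplacian_y_terms (of_nat CARD('n))) es)) (y, z)"
proof -
  let ?d = "of_nat CARD('n) :: complex"
  let ?M = "\<lambda>a b c. dist_mono x a b c (y, z)"
  let ?P = "complex_of_real ((norm (x - y))\<^sup>2)"
  let ?Q = "complex_of_real ((norm (y - z))\<^sup>2)"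
  let ?R = "complex_of_real ((norm (z - x))\<^sup>2)"
  let ?X = "\<lambda>j. complex_of_real ((y - x) $ j)"
  let ?Y = "\<lambda>j. complex_of_real ((y - z) $ j)"
  let ?D2 = "\<lambda>j a b c. a * (?M (a - 2) b c + ?X j * dist_mono_dy x j (a - 2) b c (y, z))
                     + b * (?M a (b - 2) c + ?Y j * dist_mono_dy x j a (b - 2) c (y, z))"
  have first: "partial_y j (mono_sum x es) q = (\<Sum>(k, a, b, c)\<leftarrow>es. k * dist_mono_dy x j a b c q)"
    if "q \<in> distinct_locus x" for j q
    using partial_y_mono_sum[of "fst q" "snd q" x j es] that by simp
  have second: "partial_y j (partial_y j (mono_sum x es)) (y, z) = (\<Sum>(k, a, b, c)\<leftarrow>es. k * ?D2 j a b c)" for j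
  proof -
    have "partial_y j (partial_y j (mono_sum x es)) (y, z)
        = partial_y j (\<lambda>q. \<Sum>(k, a, b, c)\<leftarrow>es. k * dist_mono_dy x j a b c q) (y, z)"
      unfolding partial_y_def[of j]
      by (rule dir_deriv_cong[OF open_distinct_locus assms first[unfolded partial_y_def]])
    also have "\<dots> = (\<Sum>(k, a, b, c)\<leftarrow>es. k * ?D2 j a b c)"
      unfolding partial_y_def
    proof (rule dir_deriv_eqI, rule has_vector_derivative_sum_list)
      fix e :: dist_term
      obtain k a b c where e: "e = (k, a, b, c)" by (cases e)
      show "((\<lambda>t. case e of (k, a, b, c) \<Rightarrow> k * dist_mono_dy x j a b c ((y, z) + t *\<^sub>R (axis j 1, 0)))
         has_vector_derivative (case e of (k, a, b, c) \<Rightarrow> k * ?D2 j a b c)) (at 0)"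
        unfolding e prod.case
        by (rule has_vector_derivative_mult_right[OF has_vector_derivative_dist_mono_dy[OF assms]])
    qed
    finally show ?thesis .
  qed
  have single: "(\<Sum>j\<in>UNIV. k * ?D2 j a b c) = mono_sum x (laplacian_y_terms ?d (k, a, b, c)) (y, z)"
    for k a b c
  proof -
    have shift: "?P * ?M (a - 2 - 2) b c = ?M (a - 2) b c" "?Q * ?M a (b - 2 - 2) c = ?M a (b - 2) c"
      "?P * ?M (a - 2) (b - 2) c = ?M a (b - 2) c" "?Q * ?M (a - 2) (b - 2) c = ?M (a - 2) b c"
      "?R * ?M (a - 2) (b - 2) c = ?M (a - 2) (b - 2) (c + 2)"
      using dist_mono_shift(1)[OF assms, of "a - 2 - 2" b c] dist_mono_shift(2)[OF assms, of a "b - 2 - 2" c]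
        dist_mono_shift(1)[OF assms, of "a - 2" "b - 2" c] dist_mono_shift(2)[OF assms, of "a - 2" "b - 2" c]
        dist_mono_shift(3)[OF assms, of "a - 2" "b - 2" c]
      by simp_all
    have sums: "(\<Sum>j\<in>UNIV. ?X j * ?X j) = ?P" "(\<Sum>j\<in>UNIV. ?Y j * ?Y j) = ?Q"
      "2 * (\<Sum>j\<in>UNIV. ?X j * ?Y j) = ?P + ?Q - ?R"
      unfolding sum_component_products using arg_cong[OF law_of_cosines(1)[of y x z], of complex_of_real]
      by (simp_all add: power2_norm_eq_inner norm_minus_commute[of x y])
    \<comment> \<open>Arbitrary \<open>X\<close> and \<open>Y\<close> keep the simplifier from expanding the components of \<open>y - x\<close> and
      \<open>y - z\<close>, which would hide the inner products.\<close>
    have collect: "(\<Sum>j\<in>UNIV. k * (a * (m\<^sub>1 + X j * ((a - 2) * X j * m\<^sub>3 + b * Y j * m\<^sub>4))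
                                + b * (m\<^sub>2 + Y j * (a * X j * m\<^sub>4 + (b - 2) * Y j * m\<^sub>5))))
        = k * (?d * a * m\<^sub>1 + ?d * b * m\<^sub>2 + a * (a - 2) * ((\<Sum>j\<in>UNIV. X j * X j) * m\<^sub>3)
          + a * b * ((2 * (\<Sum>j\<in>UNIV. X j * Y j)) * m\<^sub>4) + b * (b - 2) * ((\<Sum>j\<in>UNIV. Y j * Y j) * m\<^sub>5))"
      for X Y :: "'n \<Rightarrow> complex" and m\<^sub>1 m\<^sub>2 m\<^sub>3 m\<^sub>4 m\<^sub>5
      by (simp add: sum.distrib sum_distrib_left sum_distrib_right sum_subtractf algebra_simps)
    show ?thesis
      unfolding dist_mono_dy_def prod.case collect sums
      unfolding ring_distribs(2) left_diff_distrib shift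
      by (simp add: mono_sum_def laplacian_y_terms_def algebra_simps)
  qed
  have "laplacian_y (mono_sum x es) (y, z) = (\<Sum>(k, a, b, c)\<leftarrow>es. \<Sum>j\<in>UNIV. k * ?D2 j a b c)"
    by (simp add: laplacian_y_def second sum_sum_list_swap split_def)
  also have "\<dots> = (\<Sum>e\<leftarrow>es. mono_sum x (laplacian_y_terms ?d e) (y, z))"
    by (simp only: single split_def prod.collapse)
  also have "\<dots> = mono_sum x (concat (map (laplacian_y_terms ?d) es)) (y, z)"
    by (rule sum_list_mono_sum)
  finally show ?thesis .
qed

section \<open>The first-order operator\<close>

text \<open>
  Terms of twice the operator: the law of cosines yields halves, and the factor 2 that comes with
  the operator in \<open>B\<close> clears them.
\<close>

definition euler_y_terms :: "dist_term \<Rightarrow> dist_term list" where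
  "euler_y_terms = (\<lambda>(k, a, b, c).
     [(- k * (a + 2 * b), a, b, c),
      (- k * a, a - 2, b + 2, c),
      (k * a, a - 2, b, c + 2)])"

lemma euler_y_mono_sum:
  fixes x y z :: "real^'n"
  assumes "(y, z) \<in> distinct_locus x"
  shows "2 * (\<Sum>j\<in>UNIV. complex_of_real (z $ j - y $ j) * partial_y j (mono_sum x es) (y, z))
       = mono_sum x (concat (map euler_y_terms es)) (y, z)"
proof -
  let ?M = "\<lambda>a b c. dist_mono x a b c (y, z)"
  let ?P = "complex_of_real ((norm (x - y))\<^sup>2)"
  let ?Q = "complex_of_real ((norm (y - z))\<^sup>2)"
  let ?R = "complex_of_real ((norm (z - x))\<^sup>2)"
  let ?X = "\<lambda>j. complex_of_real ((y - x) $ j)"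
  let ?Y = "\<lambda>j. complex_of_real ((y - z) $ j)"
  have single: "(\<Sum>j\<in>UNIV. - 2 * ?Y j * (k * dist_mono_dy x j a b c (y, z)))
      = mono_sum x (euler_y_terms (k, a, b, c)) (y, z)" for k a b c
  proof -
    have shift: "?P * ?M (a - 2) b c = ?M a b c" "?Q * ?M (a - 2) b c = ?M (a - 2) (b + 2) c"
      "?R * ?M (a - 2) b c = ?M (a - 2) b (c + 2)" "?Q * ?M a (b - 2) c = ?M a b c"
      using dist_mono_shift(1)[OF assms, of "a - 2" b c] dist_mono_shift(2)[OF assms, of "a - 2" b c]
        dist_mono_shift(3)[OF assms, of "a - 2" b c] dist_mono_shift(2)[OF assms, of a "b - 2" c]
      by simp_all
    have sums: "2 * (\<Sum>j\<in>UNIV. ?X j * ?Y j) = ?P + ?Q - ?R" "(\<Sum>j\<in>UNIV. ?Y j * ?Y j) = ?Q"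
      unfolding sum_component_products using arg_cong[OF law_of_cosines(1)[of y x z], of complex_of_real]
      by (simp_all add: power2_norm_eq_inner)
    have collect: "(\<Sum>j\<in>UNIV. - 2 * Y j * (k * (a * X j * m\<^sub>1 + b * Y j * m\<^sub>2)))
        = - k * (a * (2 * (\<Sum>j\<in>UNIV. X j * Y j) * m\<^sub>1) + 2 * b * ((\<Sum>j\<in>UNIV. Y j * Y j) * m\<^sub>2))"
      for X Y :: "'n \<Rightarrow> complex" and m\<^sub>1 m\<^sub>2
      by (simp add: sum.distrib sum_distrib_left sum_distrib_right sum_negf sum_subtractf algebra_simps)
    show ?thesis
      unfolding dist_mono_dy_def prod.case collect sums
      unfolding ring_distribs(2) left_diff_distrib shift
      by (simp add: mono_sum_def euler_y_terms_def algebra_simps)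
  qed
  have "2 * (\<Sum>j\<in>UNIV. complex_of_real (z $ j - y $ j) * partial_y j (mono_sum x es) (y, z))
      = (\<Sum>j\<in>UNIV. - 2 * ?Y j * partial_y j (mono_sum x es) (y, z))"
    by (simp add: sum_distrib_left algebra_simps)
  also have "\<dots> = (\<Sum>(k, a, b, c)\<leftarrow>es. \<Sum>j\<in>UNIV. - 2 * ?Y j * (k * dist_mono_dy x j a b c (y, z)))"
    unfolding partial_y_mono_sum[OF assms] sum_list_const_mult[symmetric] sum_sum_list_swap split_def ..
  also have "\<dots> = (\<Sum>e\<leftarrow>es. mono_sum x (euler_y_terms e) (y, z))"
    by (simp only: single split_def prod.collapse)
  also have "\<dots> = mono_sum x (concat (map euler_y_terms es)) (y, z)"
    by (rule sum_list_mono_sum)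
  finally show ?thesis .
qed

section \<open>Exchanging the two variables\<close>

definition flip_term :: "dist_term \<Rightarrow> dist_term" where
  "flip_term = (\<lambda>(k, a, b, c). (k, c, b, a))"

lemma mono_sum_swap: "mono_sum x es (z, y) = mono_sum x (map flip_term es) (y, z)"
  by (induction es)
    (auto simp: mono_sum_def flip_term_def dist_mono_def norm_minus_commute mult_ac split_beta)

lemma mono_sum_comp_swap: "(\<lambda>(z, y). mono_sum x es (y, z)) = mono_sum x (map flip_term es)"
  using mono_sum_swap[of x es] by (simp add: fun_eq_iff)

lemma partial_z_swap: "partial_z j f (y, z) = partial_y j (\<lambda>(z, y). f (y, z)) (z, y)"
  by (simp add: partial_z_def partial_y_def dir_deriv_def)

lemma laplacian_z_swap: "laplacian_z f (y, z) = laplacian_y (\<lambda>(z, y). f (y, z)) (z, y)"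
proof -
  have "(\<lambda>(z, y). partial_z j f (y, z)) = partial_y j (\<lambda>(z, y). f (y, z))" for j
    by (simp add: fun_eq_iff partial_z_swap)
  then show ?thesis
    by (simp add: laplacian_z_def laplacian_y_def partial_z_swap)
qed

lemma laplacian_z_mono_sum:
  fixes x y z :: "real^'n"
  assumes "(y, z) \<in> distinct_locus x"
  shows "laplacian_z (mono_sum x es) (y, z)
       = mono_sum x (map flip_term (concat (map (laplacian_y_terms (of_nat CARD('n)))
           (map flip_term es)))) (y, z)"
  using assms
  by (simp only: laplacian_z_swap mono_sum_comp_swap laplacian_y_mono_sum swap_distinct_locus
      mono_sum_swap[of x _ z y])

lemma euler_z_mono_sum:
  fixes x y z :: "real^'n"
  assumes "(y, z) \<in> distinct_locus x"
  shows "2 * (\<Sum>j\<in>UNIV. complex_of_real (y $ j - z $ j) * partial_z j (mono_sum x es) (y, z))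
       = mono_sum x (map flip_term (concat (map euler_y_terms (map flip_term es)))) (y, z)"
  using assms
  by (simp only: partial_z_swap mono_sum_comp_swap euler_y_mono_sum swap_distinct_locus
      mono_sum_swap[of x _ z y])

section \<open>The mixed second-order term\<close>

text \<open>As for \<open>euler_y_terms\<close>, these are the terms of twice the operator.\<close>

definition mixed_terms :: "complex \<Rightarrow> complex \<Rightarrow> complex \<Rightarrow> complex \<Rightarrow> dist_term list" where
  "mixed_terms d a b c =
     [(c * (a - b), a, b, c - 2),
      (a * (c - b), a - 2, b, c),
      (- a * c, a - 2, b + 2, c - 2),
      (b * c, a + 2, b - 2, c - 2),
      (a * b, a - 2, b - 2, c + 2),
      (- b * (a + c + 2 * (b - 2 + d)), a, b - 2, c)]"

text \<open>
  Here all three vertices of the triangle contribute: the products of the derivatives of two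
  different powers give the inner products at \<open>x\<close>, \<open>z\<close> and \<open>y\<close>, in this order. Differentiating
  the power of \<open>|y - z|\<close> in both variables gives \<open>- b (b - 2 + d) M(a, b-2, c)\<close>.
\<close>

lemma mixed_dist_mono:
  fixes x y z :: "real^'n"
  assumes "(y, z) \<in> distinct_locus x"
  shows "2 * (\<Sum>j\<in>UNIV. partial_y j (partial_z j (dist_mono x a b c)) (y, z))
       = mono_sum x (mixed_terms (of_nat CARD('n)) a b c) (y, z)"
proof -
  let ?d = "of_nat CARD('n) :: complex"
  let ?P = "complex_of_real ((norm (x - y))\<^sup>2)"
  let ?Q = "complex_of_real ((norm (y - z))\<^sup>2)"
  let ?R = "complex_of_real ((norm (z - x))\<^sup>2)"
  let ?M = "\<lambda>a b c. dist_mono x a b c (y, z)"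
  let ?X = "\<lambda>j. complex_of_real ((y - x) $ j)"
  let ?Y = "\<lambda>j. complex_of_real ((y - z) $ j)"
  let ?Z = "\<lambda>j. complex_of_real ((z - x) $ j)"
  let ?G = "\<lambda>j q. c * (complex_of_real ((snd q - x) $ j) * dist_mono x a b (c - 2) q)
        - b * (complex_of_real ((fst q - snd q) $ j) * dist_mono x a (b - 2) c q)"
  have first: "partial_z j (dist_mono x a b c) q = ?G j q" if "q \<in> distinct_locus x" for j q
  proof -
    obtain y' z' where q: "q = (y', z')" by (cases q)
    show ?thesis
      unfolding partial_z_def q
      by (rule trans[OF dir_deriv_eqI[OF has_vector_derivative_dist_mono[OF that[unfolded q]]]])
        (simp add: inner_axis algebra_simps)
  qed
  have second: "partial_y j (partial_z j (dist_mono x a b c)) (y, z)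
      = c * (?Z j * dist_mono_dy x j a b (c - 2) (y, z))
        - b * (?Y j * dist_mono_dy x j a (b - 2) c (y, z) + ?M a (b - 2) c)" for j
  proof -
    note D = has_vector_derivative_dist_mono_y[OF assms]
    have line: "(\<lambda>t. ?G j ((y, z) + t *\<^sub>R (axis j 1, 0)))
      = (\<lambda>t. c * (?Z j * dist_mono x a b (c - 2) ((y, z) + t *\<^sub>R (axis j 1, 0)))
        - b * (complex_of_real ((y - z) $ j + t) * dist_mono x a (b - 2) c ((y, z) + t *\<^sub>R (axis j 1, 0))))"
      by (simp add: fun_eq_iff algebra_simps)
    have "partial_y j (partial_z j (dist_mono x a b c)) (y, z) = partial_y j (?G j) (y, z)"
      unfolding partial_y_def by (rule dir_deriv_cong[OF open_distinct_locus assms first])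
    also have "\<dots> = c * (?Z j * dist_mono_dy x j a b (c - 2) (y, z))
        - b * (?Y j * dist_mono_dy x j a (b - 2) c (y, z) + ?M a (b - 2) c)"
      unfolding partial_y_def
      by (rule dir_deriv_eqI, unfold line, rule has_vector_derivative_eq_rhs[OF has_vector_derivative_diff[OF
         has_vector_derivative_mult_right[OF has_vector_derivative_mult_right[OF D]]
         has_vector_derivative_mult_right[OF has_vector_derivative_mult[OF has_vector_derivative_component D]]]])
        simp
    finally show ?thesis .
  qed
  have shift: "?P * ?M (a - 2) b (c - 2) = ?M a b (c - 2)" "?R * ?M (a - 2) b (c - 2) = ?M (a - 2) b c"
    "?Q * ?M (a - 2) b (c - 2) = ?M (a - 2) (b + 2) (c - 2)"
    "?P * ?M a (b - 2) (c - 2) = ?M (a + 2) (b - 2) (c - 2)"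
    "?Q * ?M a (b - 2) (c - 2) = ?M a b (c - 2)" "?R * ?M a (b - 2) (c - 2) = ?M a (b - 2) c"
    "?P * ?M (a - 2) (b - 2) c = ?M a (b - 2) c" "?Q * ?M (a - 2) (b - 2) c = ?M (a - 2) b c"
    "?R * ?M (a - 2) (b - 2) c = ?M (a - 2) (b - 2) (c + 2)" "?Q * ?M a (b - 2 - 2) c = ?M a (b - 2) c"
    using dist_mono_shift(1)[OF assms, of "a - 2" b "c - 2"] dist_mono_shift(3)[OF assms, of "a - 2" b "c - 2"]
      dist_mono_shift(2)[OF assms, of "a - 2" b "c - 2"] dist_mono_shift(1)[OF assms, of a "b - 2" "c - 2"]
      dist_mono_shift(2)[OF assms, of a "b - 2" "c - 2"] dist_mono_shift(3)[OF assms, of a "b - 2" "c - 2"]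
      dist_mono_shift(1)[OF assms, of "a - 2" "b - 2" c] dist_mono_shift(2)[OF assms, of "a - 2" "b - 2" c]
      dist_mono_shift(3)[OF assms, of "a - 2" "b - 2" c] dist_mono_shift(2)[OF assms, of a "b - 2 - 2" c]
    by simp_all
  have sums: "2 * (\<Sum>j\<in>UNIV. ?Z j * ?X j) = ?P + ?R - ?Q" "2 * (\<Sum>j\<in>UNIV. ?Z j * ?Y j) = ?P - ?Q - ?R"
    "2 * (\<Sum>j\<in>UNIV. ?X j * ?Y j) = ?P + ?Q - ?R" "(\<Sum>j\<in>UNIV. ?Y j * ?Y j) = ?Q"
    unfolding sum_component_products
    using law_of_cosines[where x = x and y = y and z = z, THEN arg_cong[where f = complex_of_real]]
    by (simp_all add: power2_norm_eq_inner)
  have collect: "2 * (\<Sum>j\<in>UNIV. c * (Z j * (a * X j * m\<^sub>1 + b * Y j * m\<^sub>2))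
        - b * (Y j * (a * X j * m\<^sub>3 + (b - 2) * Y j * m\<^sub>4) + m\<^sub>5))
      = a * c * ((2 * (\<Sum>j\<in>UNIV. Z j * X j)) * m\<^sub>1) + b * c * ((2 * (\<Sum>j\<in>UNIV. Z j * Y j)) * m\<^sub>2)
        - a * b * ((2 * (\<Sum>j\<in>UNIV. X j * Y j)) * m\<^sub>3)
        - 2 * b * (b - 2) * ((\<Sum>j\<in>UNIV. Y j * Y j) * m\<^sub>4) - 2 * b * ?d * m\<^sub>5"
    for X Y Z :: "'n \<Rightarrow> complex" and m\<^sub>1 m\<^sub>2 m\<^sub>3 m\<^sub>4 m\<^sub>5
    by (simp add: sum.distrib sum_distrib_left sum_distrib_right sum_subtractf algebra_simps)
  show ?thesis
    unfolding second dist_mono_dy_def prod.case collect sums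
      unfolding ring_distribs(2) left_diff_distrib shift
    by (simp add: mono_sum_def mixed_terms_def algebra_simps)
qed

section \<open>The Bernstein-Sato identity\<close>

theorem theorem4p1:
  fixes \<beta> :: "complex^3" and x y z :: "real^'n"
  assumes "CARD('n) \<ge> 2"
    and "x \<noteq> y" and "y \<noteq> z" and "z \<noteq> x"
  shows "B_op \<beta> (\<lambda>(y', z'). l_fun (vector [\<beta>$1 + 2, \<beta>$2, \<beta>$3]) x y' z') (y, z)
         = b_poly CARD('n) \<beta> * l_fun \<beta> x y z"
proof -
  define d where "d = (of_nat CARD('n) :: complex)"
  have U: "(y, z) \<in> distinct_locus x"
    using assms by (simp add: distinct_locus_def)
  \<comment> \<open>The operators lower the exponents \<open>\<beta>\<^sub>3\<close>, \<open>\<beta>\<^sub>1 + 2\<close>, \<open>\<beta>\<^sub>2\<close> by at most 2, 4 and 2, so every term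
    is \<open>M(A, B, C)\<close> times a polynomial in \<open>P\<close>, \<open>Q\<close>, \<open>R\<close>.\<close>
  define A where "A = \<beta>$3 - 2"
  define B where "B = \<beta>$1 - 2"
  define C where "C = \<beta>$2 - 2"
  have \<beta>: "\<beta>$3 = A + 2" "\<beta>$1 = B + 2" "\<beta>$2 = C + 2"
    by (simp_all add: A_def B_def C_def)
  define P where "P = complex_of_real ((norm (x - y))\<^sup>2)"
  define Q where "Q = complex_of_real ((norm (y - z))\<^sup>2)"
  define R where "R = complex_of_real ((norm (z - x))\<^sup>2)"
  define m where "m = dist_mono x A B C (y, z)"

  let ?f = "dist_mono x (A + 2) (B + 4) (C + 2)"
  let ?F = "[(1, A + 2, B + 4, C + 2)]"
  have f_eq: "(\<lambda>(y', z'). l_fun (vector [\<beta>$1 + 2, \<beta>$2, \<beta>$3]) x y' z') = ?f"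
    by (simp add: l_fun_def dist_mono_def \<beta> fun_eq_iff vector_3 add.assoc)
  have f_sum: "?f = mono_sum x ?F"
    by (simp add: mono_sum_def fun_eq_iff)

  define Ey where "Ey = concat (map (laplacian_y_terms d) ?F)"
  define Ez where "Ez = map flip_term (concat (map (laplacian_y_terms d) (map flip_term ?F)))"
  have lap_y: "laplacian_y ?f q = mono_sum x Ey q" if "q \<in> distinct_locus x" for q
    using laplacian_y_mono_sum[of "fst q" "snd q" x ?F] that
    by (simp only: f_sum Ey_def d_def prod.collapse)
  have lap_z: "laplacian_z ?f q = mono_sum x Ez q" if "q \<in> distinct_locus x" for q
    using laplacian_z_mono_sum[of "fst q" "snd q" x ?F] that
    by (simp only: f_sum Ez_def d_def prod.collapse)
  have lap_lap: "laplacian_y (laplacian_z ?f) (y, z) = mono_sum x (concat (map (laplacian_y_terms d) Ez)) (y, z)"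
    unfolding d_def
    by (rule trans[OF laplacian_y_cong[OF open_distinct_locus U lap_z] laplacian_y_mono_sum[OF U]])
  have "partial_y j (laplacian_z ?f) (y, z) = partial_y j (mono_sum x Ez) (y, z)" for j
    unfolding partial_y_def by (rule dir_deriv_cong[OF open_distinct_locus U lap_z])
  then have euler_y: "2 * (\<Sum>j\<in>UNIV. complex_of_real (z $ j - y $ j) * partial_y j (laplacian_z ?f) (y, z))
      = mono_sum x (concat (map euler_y_terms Ez)) (y, z)"
    using euler_y_mono_sum[OF U, of Ez] by simp
  have "partial_z j (laplacian_y ?f) (y, z) = partial_z j (mono_sum x Ey) (y, z)" for j
    unfolding partial_z_def by (rule dir_deriv_cong[OF open_distinct_locus U lap_y])
  then have euler_z: "2 * (\<Sum>j\<in>UNIV. complex_of_real (y $ j - z $ j) * partial_z j (laplacian_y ?f) (y, z))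
      = mono_sum x (map flip_term (concat (map euler_y_terms (map flip_term Ey)))) (y, z)"
    using euler_z_mono_sum[OF U, of Ey] by simp

  note shift = dist_mono_shift[OF U, folded P_def Q_def R_def]
  have shift_more: "dist_mono x (a + 4) b c (y, z) = P\<^sup>2 * dist_mono x a b c (y, z)"
    "dist_mono x a (b + 4) c (y, z) = Q\<^sup>2 * dist_mono x a b c (y, z)"
    "dist_mono x a b (c + 4) (y, z) = R\<^sup>2 * dist_mono x a b c (y, z)"
    "dist_mono x a (b + 6) c (y, z) = Q ^ 3 * dist_mono x a b c (y, z)" for a b c
    using shift(1)[of "a + 2" b c] shift(2)[of a "b + 2" c] shift(3)[of a b "c + 2"] shift(2)[of a "b + 4" c]
    by (simp_all add: shift power2_eq_square power3_eq_cube add.assoc)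
  have exponents: "a + 2 - 2 = a" "a + 4 - 2 = a + 2" "a + 2 + 2 = a + 4" "a + 4 + 2 = a + 6" for a :: complex
    by simp_all
  have l_eq: "l_fun \<beta> x y z = P * Q * R * m"
  proof -
    have "l_fun \<beta> x y z = dist_mono x (A + 2) (B + 2) (C + 2) (y, z)"
      by (simp add: l_fun_def dist_mono_def \<beta>)
    then show ?thesis
      by (simp add: shift m_def)
  qed

  \<comment> \<open>At the exponents of \<open>?f\<close> the factor \<open>a + b - 2 + d\<close> of \<open>laplacian_y_terms\<close> is \<open>s\<close> for \<open>\<Delta>\<^sub>y\<close> and
    \<open>t\<close> for \<open>\<Delta>\<^sub>z\<close>; this is why the coefficients of \<open>B\<close> can cancel the unwanted monomials.\<close>
  define s where "s = \<beta>$3 + \<beta>$1 + d"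
  define t where "t = \<beta>$2 + \<beta>$1 + d"
  have "B_op \<beta> ?f (y, z) =
      Q * mono_sum x (concat (map (laplacian_y_terms d) Ez)) (y, z)
    + s * mono_sum x (concat (map euler_y_terms Ez)) (y, z)
    + t * mono_sum x (map flip_term (concat (map euler_y_terms (map flip_term Ey)))) (y, z)
    + s * (\<beta>$3 + \<beta>$1 + 2) * mono_sum x Ez (y, z)
    + t * (\<beta>$2 + \<beta>$1 + 2) * mono_sum x Ey (y, z)
    - s * t * mono_sum x (mixed_terms d (A + 2) (B + 4) (C + 2)) (y, z)"
    unfolding lap_lap[symmetric] euler_y[symmetric] euler_z[symmetric] lap_y[OF U, symmetric]
      lap_z[OF U, symmetric] mixed_dist_mono[OF U, folded d_def, symmetric]
    by (simp only: B_op_def Let_def prod.case s_def t_def d_def Q_def mult.assoc mult.left_commute[of 2])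
  \<comment> \<open>With the lists written out and all exponents reduced to \<open>A\<close>, \<open>B\<close>, \<open>C\<close>, a polynomial identity in
    \<open>A\<close>, \<open>B\<close>, \<open>C\<close>, \<open>d\<close>, \<open>P\<close>, \<open>Q\<close>, \<open>R\<close> remains, times \<open>m\<close>.\<close>
  also have "\<dots> = b_poly CARD('n) \<beta> * l_fun \<beta> x y z"
    unfolding Ey_def Ez_def laplacian_y_terms_def euler_y_terms_def mixed_terms_def flip_term_def
      list.map concat.simps append.simps prod.case exponents
    unfolding mono_sum_def list.map prod.case sum_list.Cons sum_list.Nil
    unfolding shift shift_more m_def[symmetric] l_eq b_poly_def d_def[symmetric] s_def t_def \<beta>
    by algebra
  finally show ?thesis
    unfolding f_eq .
qed

end
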